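(* Let $n\in\mathbb{N}$, let $F=(F_1,\ldots,F_n)$ be an $n$-tuple of hermitian $3\times 3$ complex matrices and let $D=\dim(L(F))$. If $D\geq 6$, then $L(F)$ is not an oval. If all matrices $F_1,\ldots,F_n$ are real symmetric and $D\geq 4$, then $L(F)$ is not an oval.
   Context: For an $n$-tuple $F=(F_1,\ldots,F_n)$ of hermitian $3\times3$ complex matrices the joint algebraic numerical range is $$L(F)=\{(\operatorname{tr}(\rho F_1),\ldots,\operatorname{tr}(\rho F_n))\mid \rho\in\mathcal{M}_3\}\subset\mathbb{R}^n,$$ where $\mathcal{M}_3$ is the set of positive semi-definite $3\times 3$ complex matrices of trace one. Its dimension is the dimension of its affine hull. An oval in $\mathbb{R}^m$ is a convex and compact subset $C\subset\mathbb{R}^m$ with interior points such that every boundary point of $C$ is a smooth exposed point. Here a point $x\in C$ is an exposed point if $\{x\}$ is the set of maximizers over $C$ of some linear functional, and a boundary point $x$ of $C$ is smooth if there is a unique unit vector $u$ with $\langle u,y-x\rangle\leq 0$ for all $y\in C$. *)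

theory Defs
  imports "HOL-Analysis.Analysis"
begin

section \<open>Joint algebraic numerical ranges\<close>

definition hermitian :: "complex^'k^'k \<Rightarrow> bool" where
  "hermitian A \<longleftrightarrow> map_matrix cnj (transpose A) = A"

definition real_symmetric :: "complex^'k^'k \<Rightarrow> bool" where
  "real_symmetric A \<longleftrightarrow> transpose A = A \<and> (\<forall>i j. A $ i $ j \<in> \<real>)"

definition pos_semidef :: "complex^'k^'k \<Rightarrow> bool" where
  "pos_semidef A \<longleftrightarrow> hermitian A \<and>
     (\<forall>v :: complex^'k. 0 \<le> Re (\<Sum>i\<in>UNIV. cnj (v $ i) * (A *v v) $ i))"

definition density_matrices :: "(complex^'k^'k) set" where
  "density_matrices = {\<rho>. pos_semidef \<rho> \<and> trace \<rho> = 1}"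

text \<open>For hermitian \<open>F i\<close> the number \<open>trace (\<rho> ** F i)\<close> is real (lemma
  \<open>Im_trace_hermitian_mult\<close> below), so that \<open>Re\<close> only performs the type conversion.\<close>

definition joint_num_range :: "('n \<Rightarrow> complex^'k^'k) \<Rightarrow> (real^'n) set" where
  "joint_num_range F = (\<lambda>\<rho>. \<chi> i. Re (trace (\<rho> ** F i))) ` density_matrices"

lemma hermitian_nth: "hermitian A \<Longrightarrow> cnj (A $ i $ j) = A $ j $ i"
  unfolding hermitian_def vec_eq_iff by (simp add: transpose_def)

lemma Im_trace_hermitian_mult:
  assumes "hermitian A" "hermitian B"
  shows "Im (trace (A ** B)) = 0"
proof -
  have "cnj (trace (A ** B)) = (\<Sum>i\<in>UNIV. \<Sum>k\<in>UNIV. A $ k $ i * B $ i $ k)"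
    by (simp add: trace_def matrix_matrix_mult_def hermitian_nth assms)
  also have "\<dots> = trace (A ** B)"
    unfolding trace_def matrix_matrix_mult_def by (subst sum.swap) simp
  finally show ?thesis
    by (simp add: complex_eq_iff)
qed


section \<open>Ovals\<close>

definition exposed_point :: "'a::euclidean_space set \<Rightarrow> 'a \<Rightarrow> bool" where
  "exposed_point C x \<longleftrightarrow> (\<exists>f :: 'a \<Rightarrow> real. linear f \<and> {y\<in>C. \<forall>z\<in>C. f z \<le> f y} = {x})"

definition smooth_point :: "'a::euclidean_space set \<Rightarrow> 'a \<Rightarrow> bool" where
  "smooth_point C x \<longleftrightarrow> (\<exists>!u. norm u = 1 \<and> (\<forall>y\<in>C. u \<bullet> (y - x) \<le> 0))"

definition oval :: "'a::euclidean_space set \<Rightarrow> bool" where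
  "oval C \<longleftrightarrow> convex C \<and> compact C \<and> interior C \<noteq> {} \<and>
     (\<forall>x\<in>frontier C. smooth_point C x \<and> exposed_point C x)"

text \<open>A set of dimension smaller than that of the ambient space has empty interior and hence is never
  an oval in the ambient space. The following notion regards \<open>C\<close> as a subset of its affine hull, a
  Euclidean space of dimension \<open>aff_dim C\<close>: interior, boundary and unit normal vectors are those
  of the affine hull. For \<open>x \<in> C\<close> the span below is the direction space of the
  affine hull of \<open>C\<close>. A linear functional on the direction space extends to the ambient space,
  so that exposed points need no relative version.\<close>

definition rel_smooth_point :: "'a::euclidean_space set \<Rightarrow> 'a \<Rightarrow> bool" where
  "rel_smooth_point C x \<longleftrightarrow>
     (\<exists>!u. u \<in> span ((\<lambda>y. y - x) ` C) \<and> norm u = 1 \<and> (\<forall>y\<in>C. u \<bullet> (y - x) \<le> 0))"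

definition rel_oval :: "'a::euclidean_space set \<Rightarrow> bool" where
  "rel_oval C \<longleftrightarrow> convex C \<and> compact C \<and> rel_interior C \<noteq> {} \<and>
     (\<forall>x\<in>rel_frontier C. rel_smooth_point C x \<and> exposed_point C x)"

lemma rel_oval_iff_oval:
  fixes C :: "'a::euclidean_space set"
  assumes "interior C \<noteq> {}"
  shows "rel_oval C \<longleftrightarrow> oval C"
proof -
  have hull: "affine hull C = UNIV"
    using assms by (rule affine_hull_nonempty_interior)
  have span: "span ((\<lambda>y. y - x) ` C) = UNIV" if "x \<in> C" for x
  proof -
    have *: "affine hull C = {x + v |v. v \<in> span ((\<lambda>y. - x + y) ` (C - {x}))}"
      using affine_hull_span2 that by blast
    have "v \<in> span ((\<lambda>y. y - x) ` C)" for v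
    proof -
      have "x + v \<in> affine hull C" by (simp add: hull)
      then have "v \<in> span ((\<lambda>y. - x + y) ` (C - {x}))" unfolding * by auto
      moreover have "(\<lambda>y. - x + y) ` (C - {x}) \<subseteq> (\<lambda>y. y - x) ` C" by auto
      ultimately show ?thesis using span_mono by blast
    qed
    then show ?thesis by blast
  qed
  have "rel_smooth_point C x = smooth_point C x" if "x \<in> C" for x
    by (simp add: rel_smooth_point_def smooth_point_def span that)
  moreover have "frontier C \<subseteq> C" if "compact C"
    using that by (simp add: compact_imp_closed frontier_subset_closed)
  moreover have "rel_frontier C = frontier C" "rel_interior C = interior C"
    using assms by (simp_all add: rel_frontier_nonempty_interior rel_interior_nonempty_interior)
  ultimately show ?thesis
    unfolding rel_oval_def oval_def by (metis assms subsetD)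
qed

end

theory Submission
  imports Defs
begin

text \<open>
  The obstruction is a dimension count. Every density matrix is a convex combination of the pure
  states \<open>v v\<^sup>*\<close> with \<open>v\<close> a unit vector, so \<open>L(F)\<close> is the convex hull of the points
  \<open>(v\<^sup>* F\<^sub>i v)\<^sub>i\<close>. If \<open>L(F)\<close> is an oval of dimension \<open>D\<close>, then its boundary, a
  sphere of dimension \<open>D - 1\<close>, consists of extreme points, and these are all images of pure states.
  The pure states form a manifold of real dimension \<open>4\<close> (the complex projective plane), and a smooth
  map does not raise dimension; hence \<open>D - 1 \<le> 4\<close>. If the \<open>F\<^sub>i\<close> are real, the real unit
  vectors already generate \<open>L(F)\<close>: for \<open>v = x + \<i> y\<close> the value at \<open>v\<close> is the
  sum of the values at \<open>x\<close> and \<open>y\<close>. The projective plane is then the real one, and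
  \<open>D - 1 \<le> 2\<close>.

  The count is carried out with Lebesgue null sets, on solid bodies instead of boundaries.
  From a relative interior point \<open>c\<close> every ray in the affine hull meets the relative boundary, so
  \<open>L(F) - c\<close> lies in the cone over the pure state points, that is, in the range of
  \<open>w \<mapsto> (w\<^sup>* F\<^sub>i w)\<^sub>i - |w|\<^sup>2 c\<close> for \<open>w\<close> of arbitrary norm. The radius of the cone is
  thus absorbed into \<open>w\<close>, and the map is a quadratic polynomial. Since the phase of \<open>w\<close> is
  immaterial, its first coordinate may be taken real, which leaves five real parameters in the
  complex case and three in the real case. A linear image of \<open>L(F) - c\<close> in a space of larger dimension is
  therefore negligible (\<open>aff_dim_le_of_lowdim_cone\<close>), whereas a convex set whose dimension is
  that of the space is not.
\<close>

section \<open>Positive semi-definite matrices as sums of outer products\<close>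

definition outer :: "complex^'k \<Rightarrow> complex^'k \<Rightarrow> complex^'k^'k" where
  "outer v w = (\<chi> i j. v $ i * cnj (w $ j))"

definition sesq :: "complex^'k^'k \<Rightarrow> complex^'k \<Rightarrow> complex^'k \<Rightarrow> complex" where
  "sesq A v w = (\<Sum>i\<in>UNIV. cnj (v $ i) * (A *v w) $ i)"

lemma outer_nth [simp]: "outer v w $ i $ j = v $ i * cnj (w $ j)"
  by (simp add: outer_def)

lemma pos_semidef_iff_sesq:
  "pos_semidef A \<longleftrightarrow> hermitian A \<and> (\<forall>v. 0 \<le> Re (sesq A v v))"
  by (simp add: pos_semidef_def sesq_def)

lemma sesq_sym: "hermitian A \<Longrightarrow> sesq A v w = cnj (sesq A w v)"
  unfolding sesq_def matrix_vector_mult_def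
  apply (simp add: sum_distrib_left hermitian_nth)
  apply (subst sum.swap)
  apply (simp add: algebra_simps)
  done

lemma sesq_axis: "sesq A (axis k t) w = cnj t * (A *v w) $ k"
proof -
  have "sesq A (axis k t) w = (\<Sum>i\<in>UNIV. if i = k then cnj t * (A *v w) $ k else 0)"
    unfolding sesq_def by (rule sum.cong) (auto simp: axis_def)
  then show ?thesis by simp
qed

lemma sesq_add_left: "sesq A (u + v) w = sesq A u w + sesq A v w"
  by (simp add: sesq_def distrib_right sum.distrib)

lemma sesq_add_right: "sesq A u (v + w) = sesq A u v + sesq A u w"
  by (simp add: sesq_def matrix_vector_right_distrib distrib_left sum.distrib)

lemma matrix_vector_mult_axis: "(A *v axis k t) $ i = A $ i $ k * (t::complex)"
proof -
  have "(A *v axis k t) $ i = (\<Sum>j\<in>UNIV. if j = k then A $ i $ k * t else 0)"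
    unfolding matrix_vector_mult_def vec_lambda_beta
    by (rule sum.cong) (auto simp: axis_def)
  then show ?thesis by simp
qed

lemma hermitian_diag: "hermitian A \<Longrightarrow> A $ k $ k = of_real (Re (A $ k $ k))"
  using hermitian_nth[of A k k] by (simp add: complex_eq_iff)

text \<open>The real quadratic in a single coordinate of the argument. Letting \<open>t\<close> vary turns positivity of
  the form into information on the \<open>k\<close>-th row, as in the proof of the Cauchy-Schwarz inequality.\<close>

lemma sesq_perturb:
  assumes "hermitian A"
  shows "Re (sesq A (v + axis k t) (v + axis k t))
           = Re (sesq A v v) + 2 * Re (cnj t * (A *v v) $ k) + (cmod t)\<^sup>2 * Re (A $ k $ k)"
proof -
  have 1: "Re (sesq A v (axis k t)) = Re (cnj t * (A *v v) $ k)"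
    by (subst sesq_sym[OF assms]) (simp add: sesq_axis)
  have "sesq A (axis k t) (axis k t) = (t * cnj t) * A $ k $ k"
    by (simp add: sesq_axis matrix_vector_mult_axis)
  also have "\<dots> = of_real ((cmod t)\<^sup>2) * of_real (Re (A $ k $ k))"
    using hermitian_diag[OF assms, of k] by (metis complex_norm_square)
  finally have 2: "Re (sesq A (axis k t) (axis k t)) = (cmod t)\<^sup>2 * Re (A $ k $ k)"
    by simp
  show ?thesis
    using 1 2 by (simp add: sesq_add_left sesq_add_right sesq_axis[of A k t v])
qed

lemma pos_semidef_diag_nonneg:
  assumes "pos_semidef A"
  shows "0 \<le> Re (A $ k $ k)"
  using assms sesq_axis[of A k 1 "axis k 1"]
  by (metis complex_cnj_one matrix_vector_mult_axis mult.commute mult_1 pos_semidef_iff_sesq)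

text \<open>If a diagonal entry vanishes, the form is affine along that coordinate, and an affine
  function that is bounded below has slope zero.\<close>

lemma pos_semidef_zero_diag:
  assumes A: "pos_semidef A" and "A $ k $ k = 0"
  shows "A $ k $ j = 0"
proof (rule ccontr)
  assume ne: "A $ k $ j \<noteq> 0"
  define a where "a = A $ k $ j"
  define v :: "complex^'a" where "v = axis j 1"
  \<comment> \<open>moving by \<open>- s a\<close> lowers the form by \<open>2 s |a|\<^sup>2\<close>; this \<open>s\<close> makes its value \<open>- 1\<close>\<close>
  define s where "s = (Re (sesq A v v) + 1) / (2 * (cmod a)\<^sup>2)"
  have a: "(A *v v) $ k = a" "a \<noteq> 0"
    using ne by (simp_all add: v_def a_def matrix_vector_mult_axis)
  have "Re (cnj (- of_real s * a) * a) = - s * (cmod a)\<^sup>2"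
    by (simp add: cmod_power2) (simp add: power2_eq_square algebra_simps)
  moreover have "0 \<le> Re (sesq A v v) + 2 * Re (cnj (- of_real s * a) * (A *v v) $ k)
      + (cmod (- of_real s * a))\<^sup>2 * Re (A $ k $ k)"
    using A sesq_perturb[of A v k "- of_real s * a"] unfolding pos_semidef_iff_sesq by metis
  ultimately have "0 \<le> Re (sesq A v v) - 2 * s * (cmod a)\<^sup>2"
    using assms(2) a by simp
  also have "2 * s * (cmod a)\<^sup>2 = Re (sesq A v v) + 1"
    using a by (simp add: s_def)
  finally show False by simp
qed

text \<open>One step of the Cholesky decomposition: \<open>u\<close> is chosen such that \<open>u u\<^sup>*\<close> agrees with \<open>A\<close> in
  the \<open>k\<close>-th row and column. The form of the difference at \<open>v\<close> is the minimum of the form of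
  \<open>A\<close> along the line through \<open>v\<close> in direction \<open>k\<close>, hence nonnegative.\<close>

lemma pos_semidef_schur_complement:
  assumes A: "pos_semidef A" and pos: "0 < Re (A $ k $ k)"
  defines "u \<equiv> (\<chi> i. A $ i $ k / of_real (sqrt (Re (A $ k $ k))))"
  shows "pos_semidef (A - outer u u)" "(A - outer u u) $ k $ k = 0"
proof -
  define a where "a = Re (A $ k $ k)"
  have h: "hermitian A" using A by (simp add: pos_semidef_def)
  have a: "a > 0" "A $ k $ k = of_real a"
    using pos hermitian_diag[OF h, of k] by (simp_all add: a_def)
  have sq: "of_real (sqrt a) * of_real (sqrt a) = (of_real a :: complex)"
    using a(1) by (simp flip: of_real_mult)
  have uu: "outer u u $ i $ j = A $ i $ k * A $ k $ j / of_real a" for i j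
    using a sq by (simp add: u_def hermitian_nth[OF h] flip: a_def)
  show "(A - outer u u) $ k $ k = 0"
    using a by (simp add: uu del: outer_nth)
  have "hermitian (A - outer u u)"
    unfolding hermitian_def vec_eq_iff
    by (simp add: transpose_def hermitian_nth[OF h] mult.commute)
  moreover have "0 \<le> Re (sesq (A - outer u u) v v)" for v
  proof -
    define b where "b = (A *v v) $ k"
    have cb: "(\<Sum>i\<in>UNIV. cnj (v $ i) * A $ i $ k) = cnj b"
      by (simp add: b_def matrix_vector_mult_def hermitian_nth[OF h] mult.commute)
    have "(outer u u *v v) $ i = A $ i $ k * b / of_real a" for i
      unfolding matrix_vector_mult_def b_def
      by (simp add: uu sum_distrib_left sum_divide_distrib mult.assoc del: outer_nth)
    then have "sesq (outer u u) v v = (\<Sum>i\<in>UNIV. cnj (v $ i) * A $ i $ k) * b / of_real a"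
      unfolding sesq_def by (simp add: sum_distrib_right sum_divide_distrib mult.assoc)
    also have "\<dots> = of_real ((cmod b)\<^sup>2 / a)"
      unfolding cb by (metis complex_norm_square mult.commute of_real_divide)
    finally have 1: "Re (sesq (outer u u) v v) = (cmod b)\<^sup>2 / a"
      by simp
    have 2: "sesq (A - outer u u) v v = sesq A v v - sesq (outer u u) v v"
      by (simp add: sesq_def matrix_vector_mult_diff_rdistrib right_diff_distrib sum_subtractf)
    \<comment> \<open>the minimizer of the quadratic in \<open>sesq_perturb\<close>\<close>
    define t where "t = - b / of_real a"
    have "0 \<le> Re (sesq A v v) + 2 * Re (cnj t * b) + (cmod t)\<^sup>2 * a"
      using A sesq_perturb[OF h, of v k t] unfolding pos_semidef_iff_sesq a_def b_def by metis
    moreover have "Re (cnj t * b) = - ((cmod b)\<^sup>2 / a)"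
    proof -
      have "cnj t * b = - of_real ((cmod b)\<^sup>2 / a)"
        by (simp add: t_def complex_norm_square mult.commute del: of_real_power)
      then show ?thesis by simp
    qed
    moreover have "(cmod t)\<^sup>2 * a = (cmod b)\<^sup>2 / a"
      using a(1) by (simp add: t_def norm_divide power_divide power2_eq_square)
    ultimately show ?thesis using 1 2 by simp
  qed
  ultimately show "pos_semidef (A - outer u u)"
    by (simp add: pos_semidef_iff_sesq)
qed

text \<open>Cholesky decomposition. The induction is on a set containing the indices of the nonzero
  diagonal entries: splitting off a Schur complement removes an index and adds none,
  because a zero diagonal entry forces a zero row.\<close>

lemma pos_semidef_sum_outer_on:
  assumes "finite I" "pos_semidef A" "\<And>k. k \<notin> I \<Longrightarrow> A $ k $ k = 0"
  shows "\<exists>u. A = (\<Sum>k\<in>I. outer (u k) (u k))"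
  using assms
proof (induction I arbitrary: A rule: finite_induct)
  case empty
  then have "A $ k $ j = 0" for k j
    by (rule pos_semidef_zero_diag) auto
  then have "A = 0"
    by (simp add: vec_eq_iff)
  then show ?case by simp
next
  case (insert k I)
  have "\<exists>u. pos_semidef (A - outer u u) \<and> (\<forall>j. j \<notin> I \<longrightarrow> (A - outer u u) $ j $ j = 0)"
  proof (cases "A $ k $ k = 0")
    case True
    have "A - outer 0 0 = A" by (simp add: vec_eq_iff)
    moreover have "A $ j $ j = 0" if "j \<notin> I" for j
      using insert.prems(2)[of j] True that by (cases "j = k") auto
    ultimately show ?thesis
      using insert.prems(1) by (intro exI[of _ 0]) simp
  next
    case False
    define u where "u = (\<chi> i. A $ i $ k / of_real (sqrt (Re (A $ k $ k))))"
    have h: "hermitian A" using insert.prems(1) by (simp add: pos_semidef_def)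
    have "Im (A $ k $ k) = 0"
      using arg_cong[OF hermitian_diag[OF h, of k], of Im] by simp
    then have pos: "0 < Re (A $ k $ k)"
      using False pos_semidef_diag_nonneg[OF insert.prems(1), of k]
      by (simp add: complex_eq_iff)
    note schur = pos_semidef_schur_complement[OF insert.prems(1) pos, folded u_def]
    have "(A - outer u u) $ j $ j = 0" if "j \<notin> I" for j
    proof (cases "j = k")
      case False
      then have "A $ j $ j = 0" using that insert.prems(2) by blast
      moreover from this have "u $ j = 0"
        using pos_semidef_zero_diag[OF insert.prems(1), of j k] by (simp add: u_def)
      ultimately show ?thesis by simp
    next
      case True
      then show ?thesis using schur(2) by (simp only:)
    qed
    then show ?thesis using schur(1) by blast
  qed
  then obtain u where u: "pos_semidef (A - outer u u)"
      "\<And>j. j \<notin> I \<Longrightarrow> (A - outer u u) $ j $ j = 0"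
    by blast
  from insert.IH[OF this] obtain w where w: "A - outer u u = (\<Sum>j\<in>I. outer (w j) (w j))"
    by blast
  have "A = (\<Sum>j\<in>insert k I. outer ((w(k := u)) j) ((w(k := u)) j))"
  proof -
    have "(\<Sum>j\<in>I. outer ((w(k := u)) j) ((w(k := u)) j)) = (\<Sum>j\<in>I. outer (w j) (w j))"
      using insert.hyps by (intro sum.cong) auto
    then have "(\<Sum>j\<in>insert k I. outer ((w(k := u)) j) ((w(k := u)) j)) = outer u u + (A - outer u u)"
      unfolding sum.insert[OF insert.hyps] w by simp
    then show ?thesis by (simp only: add_diff_eq add_diff_cancel_left')
  qed
  then show ?case by blast
qed

section \<open>Density matrices and numerical ranges as convex hulls\<close>

lemma trace_outer: "trace (outer v v) = of_real ((norm v)\<^sup>2)"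
  by (simp add: trace_def norm_vec_def L2_set_def sum_nonneg flip: complex_norm_square)

lemma outer_scaleR: "outer (r *\<^sub>R v) (r *\<^sub>R v) = r\<^sup>2 *\<^sub>R outer v v"
  by (simp add: vec_eq_iff power2_eq_square)

lemma pos_semidef_outer: "pos_semidef (outer v v)"
proof -
  have "hermitian (outer v v)"
    unfolding hermitian_def vec_eq_iff by (simp add: transpose_def mult.commute)
  moreover have "0 \<le> Re (sesq (outer v v) w w)" for w
  proof -
    define s where "s = (\<Sum>i\<in>UNIV. cnj (w $ i) * v $ i)"
    have "(outer v v *v w) $ i = v $ i * cnj s" for i
      by (simp add: matrix_vector_mult_def s_def sum_distrib_left algebra_simps)
    then have "sesq (outer v v) w w = s * cnj s"
      by (simp add: sesq_def s_def sum_distrib_right mult.assoc)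
    also have "\<dots> = of_real ((cmod s)\<^sup>2)" by (simp only: complex_norm_square)
    finally show ?thesis by simp
  qed
  ultimately show ?thesis by (simp add: pos_semidef_iff_sesq)
qed

lemma convex_density_matrices: "convex (density_matrices :: (complex^'k^'k) set)"
proof (rule convexI)
  fix A B :: "complex^'k^'k" and x y :: real
  assume *: "A \<in> density_matrices" "B \<in> density_matrices" "0 \<le> x" "0 \<le> y" "x + y = 1"
  have h: "hermitian A" "hermitian B"
    using * by (auto simp: density_matrices_def pos_semidef_def)
  have "hermitian (x *\<^sub>R A + y *\<^sub>R B)"
    unfolding hermitian_def vec_eq_iff by (simp add: transpose_def hermitian_nth h)
  moreover have "0 \<le> Re (sesq (x *\<^sub>R A + y *\<^sub>R B) v v)" for v
  proof -
    have "((r *\<^sub>R M) *v v) $ i = r *\<^sub>R (M *v v) $ i" for r i and M :: "complex^'k^'k"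
      by (simp add: matrix_vector_mult_def scaleR_right.sum)
    then have "sesq (x *\<^sub>R A + y *\<^sub>R B) v v = x *\<^sub>R sesq A v v + y *\<^sub>R sesq B v v"
      by (simp add: sesq_def matrix_vector_mult_add_rdistrib distrib_left sum.distrib
          scaleR_right.sum)
    moreover have "0 \<le> Re (sesq A v v)" "0 \<le> Re (sesq B v v)"
      using *(1,2) by (simp_all add: density_matrices_def pos_semidef_iff_sesq)
    ultimately show ?thesis using *(3,4) by simp
  qed
  moreover have "trace (x *\<^sub>R A + y *\<^sub>R B) = 1"
  proof -
    have "trace (x *\<^sub>R A + y *\<^sub>R B) = x *\<^sub>R trace A + y *\<^sub>R trace B"
      by (simp add: trace_def sum.distrib scaleR_right.sum)
    also have "\<dots> = (x + y) *\<^sub>R 1"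
      using *(1,2) by (simp only: density_matrices_def mem_Collect_eq scaleR_add_left)
    finally show ?thesis unfolding *(5) by simp
  qed
  ultimately show "x *\<^sub>R A + y *\<^sub>R B \<in> density_matrices"
    by (simp add: density_matrices_def pos_semidef_iff_sesq)
qed

text \<open>In \<open>\<rho> = \<Sum>\<^sub>k u\<^sub>k u\<^sub>k\<^sup>*\<close> the squared norms of the \<open>u\<^sub>k\<close> sum up to the trace of \<open>\<rho>\<close>, so after
  normalization of the vectors they are the weights of a convex combination.\<close>

lemma density_matrices_eq_convex_hull:
  "density_matrices = convex hull ((\<lambda>v::complex^'k. outer v v) ` {v. norm v = 1})"
    (is "_ = convex hull ?P")
proof
  show "convex hull ?P \<subseteq> density_matrices"
    by (intro hull_minimal convex_density_matrices)
      (auto simp: density_matrices_def pos_semidef_outer trace_outer)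
  show "density_matrices \<subseteq> convex hull ?P"
  proof
    fix A :: "complex^'k^'k" assume "A \<in> density_matrices"
    then have A: "pos_semidef A" "trace A = 1" by (auto simp: density_matrices_def)
    have "\<exists>u :: 'k \<Rightarrow> complex^'k. A = (\<Sum>k\<in>UNIV. outer (u k) (u k))"
      by (rule pos_semidef_sum_outer_on) (simp_all add: A)
    then obtain u :: "'k \<Rightarrow> complex^'k" where u: "A = (\<Sum>k\<in>UNIV. outer (u k) (u k))" ..
    \<comment> \<open>a vector \<open>u k = 0\<close> has weight zero; any unit vector may take its place\<close>
    define w :: "'k \<Rightarrow> complex^'k" where
      "w k = (if u k = 0 then axis k 1 else u k /\<^sub>R norm (u k))" for k
    have w: "norm (w k) = 1" "u k = norm (u k) *\<^sub>R w k" for k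
      by (simp_all add: w_def)
    have "outer (u k) (u k) = (norm (u k))\<^sup>2 *\<^sub>R outer (w k) (w k)" for k
      using outer_scaleR[of "norm (u k)" "w k"] unfolding w(2)[symmetric] .
    then have A_sum: "A = (\<Sum>k\<in>UNIV. (norm (u k))\<^sup>2 *\<^sub>R outer (w k) (w k))"
      unfolding u by (rule sum.cong[OF refl])
    have norms: "(\<Sum>k\<in>UNIV. (norm (u k))\<^sup>2) = 1"
    proof -
      have "trace A = (\<Sum>k\<in>UNIV. trace (outer (u k) (u k)))"
        unfolding u trace_def sum_component by (rule sum.swap)
      also have "\<dots> = of_real (\<Sum>k\<in>UNIV. (norm (u k))\<^sup>2)"
        by (simp add: trace_outer)
      finally have "complex_of_real (\<Sum>k\<in>UNIV. (norm (u k))\<^sup>2) = 1"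
        unfolding A(2) by (rule sym)
      then show ?thesis by (simp only: of_real_eq_1_iff)
    qed
    have pure: "outer (w k) (w k) \<in> convex hull ?P" for k
      using w(1) by (intro hull_inc) auto
    show "A \<in> convex hull ?P"
      unfolding A_sum
      by (rule convex_sum[OF finite_class.finite_UNIV convex_convex_hull norms _ pure]) simp
  qed
qed

definition expectation :: "('n \<Rightarrow> complex^'k^'k) \<Rightarrow> complex^'k^'k \<Rightarrow> real^'n" where
  "expectation F \<rho> = (\<chi> i. Re (trace (\<rho> ** F i)))"

lemma linear_expectation: "linear (expectation F)"
  by (rule linearI)
    (simp_all add: vec_eq_iff expectation_def trace_def matrix_matrix_mult_def distrib_right
      sum.distrib sum_distrib_left)

lemma joint_num_range_eq_convex_hull:
  "joint_num_range F = convex hull ((\<lambda>v. expectation F (outer v v)) ` {v. norm v = 1})"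
proof -
  have "joint_num_range F = expectation F ` density_matrices"
    by (simp add: joint_num_range_def expectation_def)
  also have "\<dots> = convex hull (expectation F ` (\<lambda>v. outer v v) ` {v. norm v = 1})"
    unfolding density_matrices_eq_convex_hull
    by (rule convex_hull_linear_image[OF linear_expectation])
  finally show ?thesis by (simp add: image_image)
qed

definition complexify :: "real^'k \<Rightarrow> complex^'k" where
  "complexify x = (\<chi> i. of_real (x $ i))"

lemma complexify_nth [simp]: "complexify x $ i = of_real (x $ i)"
  by (simp add: complexify_def)

lemma linear_complexify: "linear complexify"
  by (rule linearI) (simp_all add: vec_eq_iff, simp add: scaleR_conv_of_real)

lemma norm_complexify [simp]: "norm (complexify x) = norm x"
  by (simp add: norm_vec_def)

text \<open>For real matrices only the real part of \<open>v v\<^sup>*\<close> counts, and this is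
  \<open>x x\<^sup>T + y y\<^sup>T\<close> for \<open>v = x + \<i> y\<close>.\<close>

lemma expectation_outer_real:
  assumes "\<And>i j k. F i $ j $ k \<in> \<real>"
  shows "expectation F (outer v v) =
    expectation F (outer (complexify (\<chi> j. Re (v $ j))) (complexify (\<chi> j. Re (v $ j)))) +
    expectation F (outer (complexify (\<chi> j. Im (v $ j))) (complexify (\<chi> j. Im (v $ j))))"
proof -
  have im: "Im (F i $ j $ k) = 0" for i j k
    using assms by (simp add: complex_is_Real_iff)
  show ?thesis
    by (simp add: vec_eq_iff expectation_def trace_def matrix_matrix_mult_def im
        flip: sum.distrib) (simp add: algebra_simps)
qed

text \<open>A complex pure state has the same expectation as the mixture of the two real pure states along
  the real and imaginary parts of its vector, weighted with their squared norms.\<close>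

lemma joint_num_range_real_eq_convex_hull:
  assumes "\<And>i j k. F i $ j $ k \<in> \<real>"
  shows "joint_num_range F =
    convex hull ((\<lambda>v. expectation F (outer v v)) ` {v \<in> range complexify. norm v = 1})"
    (is "_ = convex hull (?q ` ?R)")
proof
  show "convex hull (?q ` ?R) \<subseteq> joint_num_range F"
    unfolding joint_num_range_eq_convex_hull by (intro hull_mono image_mono) auto
  have scaled: "\<exists>p \<in> convex hull (?q ` ?R). ?q (complexify x) = (norm x)\<^sup>2 *\<^sub>R p" for x
  proof -
    define y where "y = (if x = 0 then axis undefined 1 else x /\<^sub>R norm x)"
    have y: "norm y = 1" "x = norm x *\<^sub>R y" by (auto simp: y_def)
    have "complexify x = norm x *\<^sub>R complexify y"
      using y(2) linear_cmul[OF linear_complexify] by metis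
    then have "?q (complexify x) = (norm x)\<^sup>2 *\<^sub>R ?q (complexify y)"
      by (simp only: outer_scaleR linear_cmul[OF linear_expectation])
    moreover have "?q (complexify y) \<in> convex hull (?q ` ?R)"
      using y(1) by (intro hull_inc) auto
    ultimately show ?thesis by blast
  qed
  have "?q v \<in> convex hull (?q ` ?R)" if "norm v = 1" for v
  proof -
    define x where "x = (\<chi> j. Re (v $ j))"
    define y where "y = (\<chi> j. Im (v $ j))"
    obtain p r where *: "p \<in> convex hull (?q ` ?R)" "?q (complexify x) = (norm x)\<^sup>2 *\<^sub>R p"
      "r \<in> convex hull (?q ` ?R)" "?q (complexify y) = (norm y)\<^sup>2 *\<^sub>R r"
      using scaled by meson
    have "(norm x)\<^sup>2 + (norm y)\<^sup>2 = (norm v)\<^sup>2"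
      by (simp add: norm_vec_def L2_set_def sum_nonneg x_def y_def cmod_power2 sum.distrib)
    then have "(norm x)\<^sup>2 *\<^sub>R p + (norm y)\<^sup>2 *\<^sub>R r \<in> convex hull (?q ` ?R)"
      using * that by (intro convexD[OF convex_convex_hull]) auto
    moreover have "?q v = (norm x)\<^sup>2 *\<^sub>R p + (norm y)\<^sup>2 *\<^sub>R r"
      using expectation_outer_real[of F v, OF assms] * by (simp add: x_def y_def)
    ultimately show ?thesis by simp
  qed
  then show "joint_num_range F \<subseteq> convex hull (?q ` ?R)"
    unfolding joint_num_range_eq_convex_hull
    by (intro hull_minimal convex_convex_hull) auto
qed

section \<open>The dimension bound\<close>

lemma exposed_point_imp_extreme_point:
  fixes C :: "'a::euclidean_space set"
  assumes "exposed_point C x"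
  shows "x extreme_point_of C"
proof -
  obtain f :: "'a \<Rightarrow> real" where f: "linear f" "{y\<in>C. \<forall>z\<in>C. f z \<le> f y} = {x}"
    using assms unfolding exposed_point_def by blast
  then have x: "x \<in> C" "\<And>z. z \<in> C \<Longrightarrow> f z \<le> f x" by blast+
  have lt: "f z < f x" if "z \<in> C" "z \<noteq> x" for z
  proof (rule ccontr)
    assume "\<not> f z < f x"
    then have "z \<in> {y\<in>C. \<forall>z\<in>C. f z \<le> f y}"
      using that(1) by (auto simp: not_less intro: order_trans[OF x(2)])
    then show False using f(2) that(2) by simp
  qed
  show ?thesis
    unfolding extreme_point_of_def
  proof (intro conjI ballI notI x(1))
    fix a b assume ab: "a \<in> C" "b \<in> C" "x \<in> open_segment a b"
    then obtain t where t: "a \<noteq> b" "0 < t" "t < 1" "x = (1 - t) *\<^sub>R a + t *\<^sub>R b"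
      by (auto simp: in_segment)
    have fx: "f x = (1 - t) * f a + t * f b"
      by (simp add: t(4) linear_add[OF f(1)] linear_cmul[OF f(1)])
    have "a \<noteq> x" "b \<noteq> x" using ab(3) by (auto simp: open_segment_def)
    then have "(1 - t) * f a + t * f b < (1 - t) * f x + t * f x"
      using lt ab t by (intro add_strict_mono mult_strict_left_mono) auto
    then show False using fx by (simp add: algebra_simps)
  qed
qed

text \<open>Null sets are those of the ambient space of a set, so a set lying in a proper affine subspace has to be
  mapped onto a full-dimensional set first; such maps are provided here.\<close>

lemma exists_linear_map_spanning:
  fixes S :: "'a::euclidean_space set"
  assumes "DIM('b::euclidean_space) \<le> dim S"
  obtains T :: "'a \<Rightarrow> 'b::euclidean_space" where "linear T" "span (T ` S) = UNIV"
proof -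
  obtain B where B: "B \<subseteq> S" "independent B" "S \<subseteq> span B" "card B = dim S"
    using basis_exists by blast
  then obtain g where g: "g ` B = (Basis :: 'b set)"
  proof -
    have "finite B" using B(2) independent_imp_finite by blast
    obtain B' where "B' \<subseteq> B" "card B' = DIM('b)"
      using assms B(4) by (metis obtain_subset_with_card_n)
    moreover from this obtain h where h: "bij_betw h B' (Basis :: 'b set)"
      using \<open>finite B\<close> by (metis finite_same_card_bij finite_Basis finite_subset)
    moreover obtain b :: 'b where "b \<in> Basis" using nonempty_Basis by blast
    ultimately have "(\<lambda>x. if x \<in> B' then h x else b) ` B = Basis"
      by (auto simp: bij_betw_def image_def) blast
    then show thesis using that by blast
  qed
  obtain T where T: "linear T" "\<forall>x\<in>B. T x = g x"
    using linear_independent_extend[OF B(2)] by blast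
  have "Basis \<subseteq> T ` S" using g T(2) B(1) by force
  then have "span (T ` S) = UNIV" using span_mono span_Basis by blast
  then show thesis using that T by blast
qed

text \<open>If the dimension of \<open>C\<close> exceeded that of the domain of \<open>g\<close>, a linear map \<open>T\<close> would send
  \<open>C - c\<close> to a convex set with interior points in a space of one dimension more than the domain.
  But a differentiable image of a space of smaller dimension is negligible.\<close>

lemma aff_dim_le_of_lowdim_cone:
  fixes C :: "'a::euclidean_space set" and g :: "'m::euclidean_space \<Rightarrow> 'a"
  assumes "convex C" "c \<in> C" "g differentiable_on UNIV"
    and cover: "(\<lambda>x. x - c) ` C \<subseteq> insert 0 (range g)"
  shows "aff_dim C \<le> DIM('m)"
proof (rule ccontr)
  assume *: "\<not> aff_dim C \<le> DIM('m)"
  define S where "S = (\<lambda>x. - c + x) ` C"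
  have S: "convex S" "0 \<in> S" "S \<subseteq> insert 0 (range g)"
    using assms convex_translation[of C "-c"] by (auto simp: S_def image_iff)
  have "aff_dim C = int (dim S)"
    unfolding S_def using assms(2) by (intro aff_dim_eq_dim hull_inc)
  with * have "DIM('m \<times> real) \<le> dim S" by simp
  then obtain T :: "'a \<Rightarrow> 'm \<times> real" where T: "linear T" "span (T ` S) = UNIV"
    by (rule exists_linear_map_spanning)
  have "negligible (range (T \<circ> g))"
  proof (rule negligible_differentiable_image_lowdim)
    show "T \<circ> g differentiable_on UNIV"
      unfolding o_def
      by (rule differentiable_on_compose[OF assms(3) linear_imp_differentiable_on[OF T(1)]])
  qed simp
  then have "negligible (insert 0 (range (T \<circ> g)))" by simp
  moreover have "T ` S \<subseteq> insert 0 (range (T \<circ> g))"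
    using S(3) linear_0[OF T(1)] by force
  ultimately have "negligible (T ` S)" by (rule negligible_subset)
  moreover have conv: "convex (T ` S)" using S(1) T(1) by (simp add: convex_linear_image)
  ultimately have "interior (T ` S) = {}" by (simp add: negligible_convex_interior)
  moreover have "affine hull (T ` S) = UNIV"
    using T S(2) by (metis affine_hull_span_0 hull_inc image_eqI linear_0)
  then have "rel_interior (T ` S) = interior (T ` S)" by (rule rel_interior_interior)
  ultimately show False using rel_interior_eq_empty[OF conv] S(2) by auto
qed

text \<open>The ray from \<open>c\<close> through \<open>x\<close> leaves \<open>C\<close> in a point of the relative boundary. In an oval this
  point is extreme, hence belongs to every generating set of \<open>C\<close>.\<close>

lemma rel_oval_in_cone_over_generators:
  assumes "rel_oval C" "c \<in> rel_interior C" "C = convex hull P"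
    and "x \<in> C" "x \<noteq> c"
  obtains p s where "p \<in> P" "0 \<le> s" "x - c = s *\<^sub>R (p - c)"
proof -
  have C: "compact C" "\<And>x. x \<in> rel_frontier C \<Longrightarrow> exposed_point C x"
    using assms(1) by (auto simp: rel_oval_def)
  have "c + (x - c) \<in> affine hull C" using assms(4) by (simp add: hull_inc)
  then obtain d where d: "0 < d" "c + d *\<^sub>R (x - c) \<in> rel_frontier C"
    using ray_to_rel_frontier[of C c "x - c"] assms(2,5) compact_imp_bounded[OF C(1)]
    by (metis eq_iff_diff_eq_0)
  define p where "p = c + d *\<^sub>R (x - c)"
  have "p \<in> P"
    using exposed_point_imp_extreme_point[OF C(2)[OF d(2)]]
    unfolding assms(3) p_def by (rule extreme_point_of_convex_hull)
  moreover have "x - c = (1 / d) *\<^sub>R (p - c)" using d(1) by (simp add: p_def)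
  ultimately show thesis using that d(1) by (metis divide_nonneg_pos zero_le_one)
qed

lemma bilinear_outer: "bilinear outer"
  unfolding bilinear_def
  by (auto intro!: linearI simp: vec_eq_iff distrib_left distrib_right)

text \<open>The map \<open>e\<close> parametrizes enough vectors to generate the numerical range linearly. Linearity makes its
  range a cone, so that one parameter space serves for the pure states and for the
  distance from \<open>c\<close>.\<close>

lemma aff_dim_rel_oval_joint_num_range_le:
  fixes e :: "'m::euclidean_space \<Rightarrow> complex^'k" and F :: "'n::finite \<Rightarrow> complex^'k^'k"
  assumes e: "linear e"
    and hull: "joint_num_range F =
      convex hull ((\<lambda>v. expectation F (outer v v)) ` {v \<in> range e. norm v = 1})"
    and oval: "rel_oval (joint_num_range F)"
  shows "aff_dim (joint_num_range F) \<le> DIM('m)"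
proof -
  obtain c where c: "c \<in> rel_interior (joint_num_range F)"
    using oval by (auto simp: rel_oval_def)
  define g where "g m = expectation F (outer (e m) (e m)) - (e m \<bullet> e m) *\<^sub>R c" for m
  have "g differentiable_on UNIV"
  proof -
    have "(\<lambda>m. outer (e m) (e m)) differentiable (at m)" for m
      using bounded_bilinear.FDERIV[OF bilinear_outer[unfolded bilinear_conv_bounded_bilinear]
          linear_imp_has_derivative[OF e] linear_imp_has_derivative[OF e]]
      unfolding differentiable_def by blast
    then have "(\<lambda>m. outer (e m) (e m)) differentiable_on UNIV"
      by (simp add: differentiable_on_def)
    then have 1: "(\<lambda>m. expectation F (outer (e m) (e m))) differentiable_on UNIV"
      by (rule differentiable_on_compose[OF _ linear_imp_differentiable_on[OF linear_expectation]])
    have 2: "(\<lambda>m. (e m \<bullet> e m) *\<^sub>R c) differentiable_on UNIV"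
      by (simp add: differentiable_on_def linear_imp_differentiable[OF e])
    show ?thesis
      unfolding g_def using 1 2 by (rule differentiable_on_diff)
  qed
  moreover have "(\<lambda>x. x - c) ` joint_num_range F \<subseteq> insert 0 (range g)"
  proof clarify
    fix x assume x: "x \<in> joint_num_range F" "x - c \<notin> range g"
    show "x - c = 0"
    proof (rule ccontr)
      assume "x - c \<noteq> 0"
      then have "x \<noteq> c" by simp
      then obtain p s where ps: "0 \<le> s" "x - c = s *\<^sub>R (p - c)"
        "p \<in> (\<lambda>v. expectation F (outer v v)) ` {v \<in> range e. norm v = 1}"
        by (rule rel_oval_in_cone_over_generators[OF oval c hull x(1)])
      then obtain m where m: "norm (e m) = 1" "p = expectation F (outer (e m) (e m))"
        by auto
      \<comment> \<open>\<open>g\<close> is quadratic, so the square root yields the factor \<open>s\<close>\<close>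
      have "g (sqrt s *\<^sub>R m) = s *\<^sub>R (p - c)"
        unfolding g_def linear_cmul[OF e] outer_scaleR linear_cmul[OF linear_expectation] m(2)
          dot_square_norm norm_scaleR m(1)
        using ps(1) by (simp add: scaleR_diff_right)
      then have "x - c = g (sqrt s *\<^sub>R m)" by (simp only: ps(2))
      then show False using x(2) by blast
    qed
  qed
  ultimately show ?thesis
    using oval c rel_interior_subset by (intro aff_dim_le_of_lowdim_cone) (auto simp: rel_oval_def)
qed

text \<open>Vectors of \<open>\<complex>\<^sup>3\<close> with real first coordinate: they represent all rays, and
  the real dimension drops from six to five.\<close>

definition phase_fixed :: "real \<times> complex \<times> complex \<Rightarrow> complex^3" where
  "phase_fixed = (\<lambda>(a, y, z). vector [of_real a, y, z])"

lemma linear_phase_fixed: "linear phase_fixed"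
  by (rule linearI)
    (auto simp: phase_fixed_def vec_eq_iff forall_3 scaleR_conv_of_real[where 'a = complex])

lemma exists_phase_fixed:
  obtains m where "norm (phase_fixed m) = norm v" "outer (phase_fixed m) (phase_fixed m) = outer v v"
proof -
  \<comment> \<open>the phase that makes the first coordinate nonnegative\<close>
  define u where "u = (if v $ 1 = 0 then 1 else cnj (v $ 1) / of_real (cmod (v $ 1)))"
  have u: "cmod u = 1" by (auto simp: u_def norm_divide)
  then have uu: "u * cnj u = 1" by (metis complex_norm_square of_real_1 power_one)
  have u1: "u * v $ 1 = of_real (cmod (v $ 1))"
  proof (cases "v $ 1 = 0")
    case False
    then show ?thesis
      using complex_norm_square[of "v $ 1"]
      by (simp add: u_def field_simps power2_eq_square)
  qed (simp add: u_def)
  define m where "m = (cmod (v $ 1), u * v $ 2, u * v $ 3)"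
  have m: "phase_fixed m $ i = u * v $ i" for i
    using exhaust_3[of i] u1 by (auto simp: m_def phase_fixed_def vector_3)
  have "norm (phase_fixed m) = norm v"
    by (simp add: norm_vec_def m norm_mult u)
  moreover have "outer (phase_fixed m) (phase_fixed m) = outer v v"
  proof -
    have "u * x * (cnj u * y) = x * y" for x y
      using uu by (metis (no_types, lifting) mult.assoc mult.commute mult_1)
    then show ?thesis by (simp add: vec_eq_iff m)
  qed
  ultimately show thesis by (rule that)
qed

theorem lemma4p7:
  fixes F :: "'n::finite \<Rightarrow> complex^3^3"
  assumes "\<And>i. hermitian (F i)"
  defines "D \<equiv> aff_dim (joint_num_range F)"
  shows "(D \<ge> 6 \<longrightarrow> \<not> oval (joint_num_range F) \<and> \<not> rel_oval (joint_num_range F)) \<and>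
         ((\<forall>i. real_symmetric (F i)) \<and> D \<ge> 4 \<longrightarrow>
            \<not> oval (joint_num_range F) \<and> \<not> rel_oval (joint_num_range F))"
proof -
  have rel: "rel_oval (joint_num_range F)" if "oval (joint_num_range F)"
    using that rel_oval_iff_oval by (auto simp: oval_def)
  have complex: "D \<le> 5" if "rel_oval (joint_num_range F)"
  proof -
    have "(\<lambda>v. expectation F (outer v v)) ` {v. norm v = 1} =
        (\<lambda>v. expectation F (outer v v)) ` {v \<in> range phase_fixed. norm v = 1}"
    proof (intro subset_antisym image_subsetI)
      fix v :: "complex^3" assume "v \<in> {v. norm v = 1}"
      moreover obtain m where "norm (phase_fixed m) = norm v"
          "outer (phase_fixed m) (phase_fixed m) = outer v v"
        by (rule exists_phase_fixed)
      ultimately show "expectation F (outer v v) \<in>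
          (\<lambda>v. expectation F (outer v v)) ` {v \<in> range phase_fixed. norm v = 1}"
        by (intro image_eqI[of _ _ "phase_fixed m"]) auto
    qed auto
    then have "joint_num_range F = convex hull
        ((\<lambda>v. expectation F (outer v v)) ` {v \<in> range phase_fixed. norm v = 1})"
      by (simp add: joint_num_range_eq_convex_hull)
    from aff_dim_rel_oval_joint_num_range_le[OF linear_phase_fixed this that]
    show ?thesis by (simp add: D_def)
  qed
  have real: "D \<le> 3" if "\<forall>i. real_symmetric (F i)" "rel_oval (joint_num_range F)"
  proof -
    have "F i $ j $ k \<in> \<real>" for i j k using that(1) by (simp add: real_symmetric_def)
    from aff_dim_rel_oval_joint_num_range_le[OF linear_complexify
        joint_num_range_real_eq_convex_hull[OF this] that(2)]
    show ?thesis by (simp add: D_def)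
  qed
  show ?thesis using rel complex real by fastforce
qed

end
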